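(* Let $\beta\in(0,t_{\pm1})$ and choose $q_\beta\in(0,\tfrac12)$ such that $\alpha_\beta(q_\beta)>0$. Let $N,m,n\in\mathbb{N}$ with $N\ge2$ and $\alpha\in\left(0,\min\{\alpha_\beta(q_\beta),\tfrac1{12}\}\right)$ be such that $$n>\alpha^{-1}\ln[N(N-1)].$$ Let $\Phi$ be an $n\times m$ Bernoulli random matrix. Define $$\tilde\theta=(1-\beta)\min\left\{\frac12-3(1-\beta)^{-1}\left[\alpha-\ln\left((1-\beta)^{1-\beta}\beta^\beta\right)\right],\ \frac12-3\alpha\right\},$$ $$\tilde\omega=1+\sqrt{12\alpha},\qquad \omega=\left(\sqrt{\frac{5\alpha}{1-\beta}}+\sqrt{2e\ln\frac{e}{1-\beta}}\right)^2.$$ Then for every $N$-point subset $\{p_1,\dots,p_N\}$ of $\mathbb{R}^m$, we have $$\mathbb{P}\left\{\tilde\theta\|p_j-p_k\|_2^2\le\frac1n\|\Phi_T(p_j-p_k)\|_2^2\le\tilde\omega\|p_j-p_k\|_2^2\ \text{ for all } T\subseteq\{1,\dots,n\}\text{ with }|T^c|\le\beta n \text{ and all } 1\le j,k\le N,\ j\ne k\right\}\ge1-N(N-1)\exp(-\alpha n)$$ and $$\mathbb{P}\left\{\frac{\tilde\theta}{1-\beta}\|p_j-p_k\|_2^2\le\frac1{|T|}\|\Phi_T(p_j-p_k)\|_2^2\le\omega\|p_j-p_k\|_2^2\ \text{ for all } T\subseteq\{1,\dots,n\}\text{ with }|T^c|\le\beta n\text{ and all } 1\le j,k\le N,\ j\ne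 k\right\}\ge1-N(N-1)\exp(-\alpha n).$$
   Context: A symmetric Bernoulli random variable takes the values $\pm1$, each with probability $\tfrac12$. An $n\times m$ Bernoulli random matrix is a random matrix whose entries are i.i.d. symmetric Bernoulli random variables. For $T\subseteq\{1,\dots,n\}$, $\Phi_T$ denotes the submatrix of $\Phi$ obtained by keeping the rows with indices in $T$, and $T^c=\{1,\dots,n\}\setminus T$. For $\beta\in(0,1)$ and $t\in(0,1)$, set $$\alpha_\beta(t):=(1-\beta)\ln(1-\beta)+\beta\ln(\beta)+\frac t3(1-\beta).$$ The number $t_{\pm1}\approx0.0376$ is the unique zero on $(0,\tfrac12)$ of the function $f(t)=(1-t)\ln(1-t)+t\ln(t)+\frac16(1-t)$. *)

theory Defs
  imports "HOL-Probability.Probability"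
begin

definition (in prob_space) symmetric_bernoulli :: "('a \<Rightarrow> real) \<Rightarrow> bool" where
  "symmetric_bernoulli X \<longleftrightarrow>
     random_variable borel X \<and>
     prob {w \<in> space M. X w = 1} = 1 / 2 \<and>
     prob {w \<in> space M. X w = - 1} = 1 / 2"

definition (in prob_space) bernoulli_matrix :: "('a \<Rightarrow> real ^ 'm ^ 'n) \<Rightarrow> bool" where
  "bernoulli_matrix \<Phi> \<longleftrightarrow>
     indep_vars (\<lambda>_. borel) (\<lambda>(i, j) w. \<Phi> w $ i $ j) (UNIV :: ('n \<times> 'm) set) \<and>
     (\<forall>i j. symmetric_bernoulli (\<lambda>w. \<Phi> w $ i $ j))"

(* The Euclidean norm of A_T x, where A_T keeps the rows of A with index in T.
   The number of rows of A_T varies with T, so A_T is not given a matrix type of its own;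
   A_T x is the family of dot products of x with the rows of A, indexed by T. *)
definition norm_rows :: "real ^ 'm ^ 'n \<Rightarrow> 'n set \<Rightarrow> real ^ 'm \<Rightarrow> real" where
  "norm_rows A T x = L2_set (\<lambda>i. row i A \<bullet> x) T"

(* On (0, 1/2) the function is strictly decreasing, positive near 0 and negative at 1/2,
   so the zero exists and is unique. *)
definition t_pm1 :: real where
  "t_pm1 = (THE t. 0 < t \<and> t < 1 / 2 \<and>
     (1 - t) * ln (1 - t) + t * ln t + 1 / 6 * (1 - t) = 0)"

definition alpha_fun :: "real \<Rightarrow> real \<Rightarrow> real" where
  "alpha_fun \<beta> t = (1 - \<beta>) * ln (1 - \<beta>) + \<beta> * ln \<beta> + t / 3 * (1 - \<beta>)"

definition theta_tilde :: "real \<Rightarrow> real \<Rightarrow> real" where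
  "theta_tilde \<beta> \<alpha> = (1 - \<beta>) *
     min (1 / 2 - 3 * inverse (1 - \<beta>) * (\<alpha> - ln ((1 - \<beta>) powr (1 - \<beta>) * \<beta> powr \<beta>)))
         (1 / 2 - 3 * \<alpha>)"

definition omega_tilde :: "real \<Rightarrow> real" where
  "omega_tilde \<alpha> = 1 + sqrt (12 * \<alpha>)"

definition omega :: "real \<Rightarrow> real \<Rightarrow> real" where
  "omega \<beta> \<alpha> =
     (sqrt (5 * \<alpha> / (1 - \<beta>)) + sqrt (2 * exp 1 * ln (exp 1 / (1 - \<beta>))))\<^sup>2"

end

theory Submission imports Defs begin

text \<open>
  Let \<open>Y\<^sub>i\<close> be the dot product of the \<open>i\<close>-th row with a unit vector. It is a Rademacher sum with
  \<open>E Y\<^sub>i\<^sup>2 = 1\<close> and \<open>E Y\<^sub>i\<^sup>4 \<le> 3\<close>, hence \<open>E exp (- Y\<^sub>i\<^sup>2 / 3) \<le> 5 / 6 \<le> exp (- 1 / 6)\<close>, while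
  \<open>E exp (h Y\<^sub>i\<^sup>2) \<le> (1 - 2 h)\<^bsup>-1/2\<^esup>\<close> for \<open>0 \<le> h < 1 / 2\<close> by comparison with a Gaussian. Chernoff's
  bound then controls the sum of \<open>Y\<^sub>i\<^sup>2\<close> over all rows from above, and over each \<open>T\<close> from below, where
  the entropy term in \<open>\<theta>\<close> pays for the union bound over all \<open>T\<close>. The upper bounds for general \<open>T\<close>
  follow from the one for all rows: dropping rows only decreases the sum, and \<open>\<beta> < 1 / 2\<close> gives
  \<open>(1 + sqrt (12 \<alpha>)) / (1 - \<beta>) \<le> 4 \<le> \<omega>\<close>.
\<close>

section \<open>Exponential moments and moments of Rademacher sums\<close>

context prob_space
begin

lemma symmetric_bernoulli_AE:
  assumes "symmetric_bernoulli X"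
  shows "AE w in M. X w = 1 \<or> X w = - 1"
proof -
  have [measurable]: "X \<in> borel_measurable M"
    using assms by (simp add: symmetric_bernoulli_def)
  have "prob ({w \<in> space M. X w = 1} \<union> {w \<in> space M. X w = - 1}) = 1 / 2 + 1 / 2"
    using assms by (subst finite_measure_Union) (auto simp: symmetric_bernoulli_def)
  moreover have "{w \<in> space M. X w = 1} \<union> {w \<in> space M. X w = - 1}
      = {w \<in> space M. X w = 1 \<or> X w = - 1}"
    by auto
  ultimately have "prob {w \<in> space M. X w = 1 \<or> X w = - 1} = 1"
    by simp
  then show ?thesis
    by (subst (asm) prob_Collect_eq_1) auto
qed

lemma symmetric_bernoulli_expectation:
  assumes "symmetric_bernoulli X"
  shows "expectation X = 0"
proof -
  have [measurable]: "X \<in> borel_measurable M"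
    using assms by (simp add: symmetric_bernoulli_def)
  have "expectation X = expectation (\<lambda>w. indicator {w \<in> space M. X w = 1} w
      - indicator {w \<in> space M. X w = - 1} w)"
    using symmetric_bernoulli_AE[OF assms] AE_space
    by (intro integral_cong_AE) (auto simp: indicator_def)
  also have "\<dots> = prob {w \<in> space M. X w = 1} - prob {w \<in> space M. X w = - 1}"
    by (subst Bochner_Integration.integral_diff)
      (simp_all add: integrable_real_indicator emeasure_eq_measure sets.Int_space_eq2)
  also have "\<dots> = 0"
    using assms by (simp add: symmetric_bernoulli_def)
  finally show ?thesis .
qed

lemma symmetric_bernoulli_uminus:
  assumes "symmetric_bernoulli X"
  shows "symmetric_bernoulli (\<lambda>w. - X w)"
proof -
  have "- x = 1 \<longleftrightarrow> x = - 1" for x :: real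
    by linarith
  then show ?thesis
    using assms by (simp add: symmetric_bernoulli_def)
qed

text \<open>Hoeffding's lemma on the interval from -1 to 1 gives the exponent
  \<open>l\<^sup>2 * 2\<^sup>2 / 8\<close>. It is applied for positive parameters; negative
  \<open>l\<close> reduces to this because \<open>- X\<close> is again symmetric Bernoulli.\<close>

lemma symmetric_bernoulli_mgf:
  assumes "symmetric_bernoulli X"
  shows "(\<integral>\<^sup>+w. exp (l * X w) \<partial>M) \<le> ennreal (exp (l\<^sup>2 / 2))"
proof -
  have pos: "(\<integral>\<^sup>+w. exp (t * Y w) \<partial>M) \<le> ennreal (exp (t\<^sup>2 / 2))"
    if "t > 0" and Y: "symmetric_bernoulli Y" for t Y
  proof -
    interpret interval_bounded_random_variable M Y "- 1" 1
      using Y symmetric_bernoulli_AE[OF Y]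
      by unfold_locales (auto simp: symmetric_bernoulli_def)
    show ?thesis
      using Hoeffdings_lemma_nn_integral_0[OF \<open>t > 0\<close> symmetric_bernoulli_expectation[OF Y]]
      by simp
  qed
  consider "l > 0" | "l = 0" | "l < 0" by linarith
  then show ?thesis
  proof cases
    case 3
    then show ?thesis
      using pos[of "- l" "\<lambda>w. - X w"] symmetric_bernoulli_uminus[OF assms] by simp
  qed (use pos assms in \<open>auto simp: emeasure_space_1\<close>)
qed

lemma rademacher_sum_mgf:
  assumes "finite J" and ind: "indep_vars (\<lambda>_. borel) X J"
    and sb: "\<And>j. j \<in> J \<Longrightarrow> symmetric_bernoulli (X j)"
  shows "(\<integral>\<^sup>+w. exp (l * (\<Sum>j\<in>J. a j * X j w)) \<partial>M) \<le> ennreal (exp (l\<^sup>2 / 2 * (\<Sum>j\<in>J. (a j)\<^sup>2)))"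
proof -
  have "(\<integral>\<^sup>+w. exp (l * (\<Sum>j\<in>J. a j * X j w)) \<partial>M)
      = (\<integral>\<^sup>+w. (\<Prod>j\<in>J. ennreal (exp ((l * a j) * X j w))) \<partial>M)"
    using \<open>finite J\<close> by (simp add: prod_ennreal exp_sum sum_distrib_left mult.assoc)
  also have "\<dots> = (\<Prod>j\<in>J. \<integral>\<^sup>+w. ennreal (exp ((l * a j) * X j w)) \<partial>M)"
    by (intro indep_vars_nn_integral \<open>finite J\<close> indep_vars_compose2[OF ind]) auto
  also have "\<dots> \<le> (\<Prod>j\<in>J. ennreal (exp ((l * a j)\<^sup>2 / 2)))"
    by (intro prod_mono_ennreal symmetric_bernoulli_mgf sb)
  also have "\<dots> = ennreal (exp (l\<^sup>2 / 2 * (\<Sum>j\<in>J. (a j)\<^sup>2)))"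
    using \<open>finite J\<close>
    by (simp add: prod_ennreal exp_sum sum_distrib_left power_mult_distrib)
  finally show ?thesis .
qed

text \<open>
  The square is linearised by \<open>exp (h x\<^sup>2) = E exp (sqrt (2 h) g x)\<close> with \<open>g\<close> standard Gaussian.
\<close>

lemma subgaussian_square_mgf:
  assumes [measurable]: "random_variable borel X"
    and mgf: "\<And>l. (\<integral>\<^sup>+w. exp (l * X w) \<partial>M) \<le> ennreal (exp (l\<^sup>2 / 2))"
    and h: "0 \<le> h" "h < 1 / 2"
  shows "(\<integral>\<^sup>+w. exp (h * (X w)\<^sup>2) \<partial>M) \<le> ennreal (1 / sqrt (1 - 2 * h))"
proof -
  define c where "c = sqrt (2 * h)"
  have c2: "c\<^sup>2 = 2 * h"
    using h by (simp add: c_def)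
  \<comment> \<open>Multiplying the standard Gaussian density by \<open>exp (h * g\<^sup>2)\<close>
    leaves the exponent \<open>- (1 - 2 * h) * g\<^sup>2 / 2\<close>, that is, \<sigma> times the
    centred Gaussian density with deviation \<sigma>. This is where \<open>h < 1 / 2\<close> is
    needed.\<close>
  define \<sigma> where "\<sigma> = 1 / sqrt (1 - 2 * h)"
  have \<sigma>: "\<sigma> > 0" and \<sigma>2: "\<sigma>\<^sup>2 = 1 / (1 - 2 * h)"
    using h by (auto simp: \<sigma>_def power_divide)
  have total: "(\<integral>\<^sup>+g. ennreal (normal_density \<mu> s g) \<partial>lborel) = 1" if "s > 0" for \<mu> s
    using that by (subst nn_integral_eq_integral) auto
  have lin: "ennreal (exp (h * x\<^sup>2)) =
      (\<integral>\<^sup>+g. ennreal (std_normal_density g * exp (c * g * x)) \<partial>lborel)" for x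
  proof -
    have "std_normal_density g * exp (c * g * x)
        = exp (h * x\<^sup>2) * normal_density (c * x) 1 g" for g
    proof -
      have "- g\<^sup>2 / 2 + c * g * x = h * x\<^sup>2 + - (g - c * x)\<^sup>2 / 2"
        using c2 by (simp add: power2_diff power_mult_distrib field_simps)
      then show ?thesis
        by (simp add: normal_density_def exp_add[symmetric] mult.left_commute)
    qed
    then show ?thesis
      by (simp add: ennreal_mult' nn_integral_cmult total)
  qed
  have gauss: "std_normal_density g * exp ((c * g)\<^sup>2 / 2) = \<sigma> * normal_density 0 \<sigma> g" for g
  proof -
    have "- g\<^sup>2 / 2 + (c * g)\<^sup>2 / 2 = - g\<^sup>2 / (2 * \<sigma>\<^sup>2)"
      using c2 h by (simp add: \<sigma>2 power_mult_distrib field_simps)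
    then show ?thesis
      using \<sigma> by (simp add: normal_density_def exp_add[symmetric] real_sqrt_mult)
  qed
  interpret pair_sigma_finite M lborel ..
  have "(\<integral>\<^sup>+w. exp (h * (X w)\<^sup>2) \<partial>M)
      = (\<integral>\<^sup>+w. (\<integral>\<^sup>+g. ennreal (std_normal_density g * exp (c * g * X w)) \<partial>lborel) \<partial>M)"
    by (simp add: lin)
  \<comment> \<open>After the exchange \<open>g\<close> is fixed in the inner integral, so
    \<open>mgf\<close> applies to it with \<open>l = c * g\<close>.\<close>
  also have "\<dots> = (\<integral>\<^sup>+g. (\<integral>\<^sup>+w. ennreal (std_normal_density g * exp (c * g * X w)) \<partial>M) \<partial>lborel)"
    by (subst Fubini') auto
  also have "\<dots> = (\<integral>\<^sup>+g. ennreal (std_normal_density g) * (\<integral>\<^sup>+w. exp (c * g * X w) \<partial>M) \<partial>lborel)"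
    by (simp add: ennreal_mult' nn_integral_cmult)
  also have "\<dots> \<le> (\<integral>\<^sup>+g. ennreal (std_normal_density g) * ennreal (exp ((c * g)\<^sup>2 / 2)) \<partial>lborel)"
    by (intro nn_integral_mono mult_left_mono mgf) auto
  also have "\<dots> = (\<integral>\<^sup>+g. ennreal (\<sigma> * normal_density 0 \<sigma> g) \<partial>lborel)"
    by (simp add: gauss ennreal_mult'[symmetric])
  also have "\<dots> = ennreal \<sigma>"
    using \<sigma> by (simp add: ennreal_mult' nn_integral_cmult total)
  finally show ?thesis
    by (simp add: \<sigma>_def)
qed

lemma integrable_power_AE_bounded:
  fixes S :: "'a \<Rightarrow> real"
  assumes [measurable]: "random_variable borel S" and "AE w in M. \<bar>S w\<bar> \<le> C"
  shows "integrable M (\<lambda>w. S w ^ k)"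
proof (rule integrable_const_bound)
  show "AE w in M. norm (S w ^ k) \<le> C ^ k"
    using assms(2) by eventually_elim (simp add: power_abs power_mono)
qed simp

text \<open>Induction on the index set: for a new sign \<open>e\<close>,
  \<open>e\<^sup>2 = 1\<close> almost everywhere, and the terms odd in \<open>e\<close> have mean
  zero by independence. The three claims go together because the step for the fourth moment uses the
  second moment, and the almost sure bound supplies integrability.\<close>

lemma rademacher_sum_moments:
  assumes "finite J" and "indep_vars (\<lambda>_. borel) X J"
    and "\<And>j. j \<in> J \<Longrightarrow> symmetric_bernoulli (X j)"
  shows "(AE w in M. \<bar>\<Sum>j\<in>J. a j * X j w\<bar> \<le> (\<Sum>j\<in>J. \<bar>a j\<bar>))
    \<and> expectation (\<lambda>w. (\<Sum>j\<in>J. a j * X j w) ^ 2) = (\<Sum>j\<in>J. (a j)\<^sup>2)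
    \<and> expectation (\<lambda>w. (\<Sum>j\<in>J. a j * X j w) ^ 4) \<le> 3 * (\<Sum>j\<in>J. (a j)\<^sup>2)\<^sup>2"
  using assms
proof (induction J rule: finite_induct)
  case empty
  then show ?case by simp
next
  case (insert i J)
  define S where "S w = (\<Sum>j\<in>J. a j * X j w)" for w
  define e where "e = X i"
  define v where "v = (\<Sum>j\<in>J. (a j)\<^sup>2)"
  have sb: "symmetric_bernoulli e"
    using insert.prems by (simp add: e_def)
  have [measurable]: "random_variable borel (X j)" if "j \<in> insert i J" for j
    using that insert.prems by (auto simp: symmetric_bernoulli_def)
  have [measurable]: "random_variable borel S" "random_variable borel e"
    unfolding S_def e_def by (auto intro!: borel_measurable_sum borel_measurable_times)
  have "indep_vars (\<lambda>_. borel) X J"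
    by (rule indep_vars_subset[OF insert.prems(1)]) auto
  from insert.IH[OF this] insert.prems(2)
  have bS: "AE w in M. \<bar>S w\<bar> \<le> (\<Sum>j\<in>J. \<bar>a j\<bar>)"
    and S2: "expectation (\<lambda>w. S w ^ 2) = v"
    and S4: "expectation (\<lambda>w. S w ^ 4) \<le> 3 * v\<^sup>2"
    by (auto simp: S_def v_def)
  have be: "AE w in M. e w = 1 \<or> e w = - 1"
    by (rule symmetric_bernoulli_AE[OF sb])
  then have be': "AE w in M. \<bar>e w\<bar> \<le> 1"
    by eventually_elim auto
  have ie: "integrable M e"
    using integrable_power_AE_bounded[OF _ be', of 1] by simp
  note iS = integrable_power_AE_bounded[OF _ bS]
  \<comment> \<open>The coefficient 1 at \<open>i\<close> makes the resulting pair consist of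
    \<open>e\<close> itself, not \<open>a i * e\<close>, and the partial sum
    \<open>S\<close>.\<close>
  have "indep_vars (\<lambda>_. borel) (\<lambda>j w. (if j = i then 1 else a j) * X j w) (insert i J)"
    by (rule indep_vars_compose2[OF insert.prems(1)]) auto
  from indep_vars_sum[OF insert.hyps(1,2) this]
  have ind: "indep_var borel e borel S"
  proof -
    have *: "(\<Sum>j\<in>J. (if j = i then 1 else a j) * X j w) = S w" for w
      unfolding S_def using insert.hyps(2) by (intro sum.cong) auto
    show ?thesis
      using \<open>indep_var borel ((\<lambda>w. (if i = i then 1 else a i) * X i w)) borel _\<close>
      by (simp add: * e_def)
  qed
  have odd: "integrable M (\<lambda>w. e w * S w ^ k)" "expectation (\<lambda>w. e w * S w ^ k) = 0" for k
  proof -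
    have "indep_var borel (id \<circ> e) borel ((\<lambda>s. s ^ k) \<circ> S)"
      by (rule indep_var_compose[OF ind]) auto
    then have I: "indep_var borel e borel (\<lambda>w. S w ^ k)"
      by (simp add: comp_def)
    show "integrable M (\<lambda>w. e w * S w ^ k)"
      by (rule indep_var_integrable[OF I ie iS]) simp
    show "expectation (\<lambda>w. e w * S w ^ k) = 0"
      by (subst indep_var_lebesgue_integral[OF I ie iS])
        (auto simp: symmetric_bernoulli_expectation[OF sb])
  qed
  have sum: "(\<Sum>j\<in>insert i J. a j * X j w) = S w + a i * e w" for w
    using insert.hyps by (simp add: S_def e_def)
  have "expectation (\<lambda>w. (S w + a i * e w) ^ 2)
      = expectation (\<lambda>w. S w ^ 2 + (a i)\<^sup>2 + 2 * a i * (e w * S w ^ 1))"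
  proof (rule integral_cong_AE)
    show "AE w in M. (S w + a i * e w) ^ 2 = S w ^ 2 + (a i)\<^sup>2 + 2 * a i * (e w * S w ^ 1)"
      using be by eventually_elim (auto simp: power2_eq_square algebra_simps)
  qed auto
  also have "\<dots> = v + (a i)\<^sup>2"
    using S2 odd odd[of 1, simplified] iS by (simp add: prob_space)
  finally have E2: "expectation (\<lambda>w. (S w + a i * e w) ^ 2) = v + (a i)\<^sup>2" .
  have "expectation (\<lambda>w. (S w + a i * e w) ^ 4)
      = expectation (\<lambda>w. S w ^ 4 + 6 * (a i)\<^sup>2 * S w ^ 2 + (a i) ^ 4
          + 4 * a i * (e w * S w ^ 3) + 4 * (a i) ^ 3 * (e w * S w ^ 1))"
  proof (rule integral_cong_AE)
    show "AE w in M. (S w + a i * e w) ^ 4 = S w ^ 4 + 6 * (a i)\<^sup>2 * S w ^ 2 + (a i) ^ 4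
          + 4 * a i * (e w * S w ^ 3) + 4 * (a i) ^ 3 * (e w * S w ^ 1)"
      using be by eventually_elim (auto simp: power4_eq_xxxx power3_eq_cube power2_eq_square algebra_simps)
  qed auto
  also have "\<dots> = expectation (\<lambda>w. S w ^ 4) + 6 * (a i)\<^sup>2 * v + (a i) ^ 4"
    using S2 odd odd[of 1, simplified] iS by (simp add: prob_space)
  \<comment> \<open>Enlarging \<open>(a i) ^ 4\<close> to three times itself completes the square in
    the next line.\<close>
  also have "\<dots> \<le> 3 * v\<^sup>2 + 6 * (a i)\<^sup>2 * v + 3 * (a i) ^ 4"
    using S4 zero_le_square[of "(a i)\<^sup>2"] by (simp add: power4_eq_xxxx power2_eq_square mult.assoc)
  also have "\<dots> = 3 * (v + (a i)\<^sup>2)\<^sup>2"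
    by (simp add: power2_eq_square power4_eq_xxxx algebra_simps)
  finally have E4: "expectation (\<lambda>w. (S w + a i * e w) ^ 4) \<le> 3 * (v + (a i)\<^sup>2)\<^sup>2" .
  have "AE w in M. \<bar>S w + a i * e w\<bar> \<le> (\<Sum>j\<in>J. \<bar>a j\<bar>) + \<bar>a i\<bar>"
    using bS be by eventually_elim auto
  then show ?case
    using E2 E4 insert.hyps unfolding sum by (simp add: v_def add.commute)
qed

text \<open>The second-order Taylor polynomial bounds \<open>exp (- u)\<close> from above for
  \<open>u \<ge> 0\<close>. With \<open>u = s * S\<^sup>2\<close> and the moment bounds its mean is
  at most \<open>1 - s + 3 * s\<^sup>2 / 2\<close>, which is smallest at \<open>s = 1 / 3\<close>,
  with value \<open>5 / 6\<close>.\<close>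

lemma rademacher_sum_laplace:
  assumes "finite J" and "indep_vars (\<lambda>_. borel) X J"
    and sb: "\<And>j. j \<in> J \<Longrightarrow> symmetric_bernoulli (X j)"
    and unit: "(\<Sum>j\<in>J. (a j)\<^sup>2) = 1"
  shows "(\<integral>\<^sup>+w. exp (- (1 / 3) * (\<Sum>j\<in>J. a j * X j w)\<^sup>2) \<partial>M) \<le> ennreal (exp (- (1 / 6)))"
proof -
  define S where "S w = (\<Sum>j\<in>J. a j * X j w)" for w
  have [measurable]: "random_variable borel S"
    unfolding S_def using sb
    by (auto intro!: borel_measurable_sum borel_measurable_times simp: symmetric_bernoulli_def)
  note mom = rademacher_sum_moments[OF assms(1-3), of a, folded S_def, unfolded unit]
  note iS = integrable_power_AE_bounded[OF _ conjunct1[OF mom]]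
  have exp_le: "exp (- u) \<le> 1 - u + u\<^sup>2 / 2" if "u \<ge> 0" for u :: real
  proof -
    have "(\<lambda>u. 1 - u + u\<^sup>2 / 2 - exp (- u)) 0 \<le> (\<lambda>u. 1 - u + u\<^sup>2 / 2 - exp (- u)) u"
    proof (rule DERIV_nonneg_imp_nondecreasing[OF that])
      fix x :: real
      have "- 1 + x + exp (- x) \<ge> 0"
        using exp_ge_add_one_self[of "- x"] by linarith
      then show "\<exists>y. ((\<lambda>u. 1 - u + u\<^sup>2 / 2 - exp (- u)) has_real_derivative y) (at x) \<and> 0 \<le> y"
        by (intro exI[of _ "- 1 + x + exp (- x)"]) (auto intro!: derivative_eq_intros)
    qed
    then show ?thesis by simp
  qed
  have "(\<integral>\<^sup>+w. exp (- (1 / 3) * (S w)\<^sup>2) \<partial>M)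
      \<le> (\<integral>\<^sup>+w. ennreal (1 - S w ^ 2 / 3 + S w ^ 4 / 18) \<partial>M)"
  proof (intro nn_integral_mono ennreal_leI)
    fix w
    show "exp (- (1 / 3) * (S w)\<^sup>2) \<le> 1 - S w ^ 2 / 3 + S w ^ 4 / 18"
      using exp_le[of "(S w)\<^sup>2 / 3"] by (simp add: power_divide flip: power_mult)
  qed
  also have "\<dots> = ennreal (expectation (\<lambda>w. 1 - S w ^ 2 / 3 + S w ^ 4 / 18))"
  proof (rule nn_integral_eq_integral)
    have "0 \<le> 1 - S w ^ 2 / 3 + S w ^ 4 / 18" for w
      using order.trans[OF exp_ge_zero exp_le[of "(S w)\<^sup>2 / 3"]]
      by (simp add: power_divide flip: power_mult)
    then show "AE w in M. 0 \<le> 1 - S w ^ 2 / 3 + S w ^ 4 / 18"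
      by simp
  qed (use iS in auto)
  also have "expectation (\<lambda>w. 1 - S w ^ 2 / 3 + S w ^ 4 / 18)
      = 1 - 1 / 3 + expectation (\<lambda>w. S w ^ 4) / 18"
    using iS mom by (simp add: prob_space)
  also have "\<dots> \<le> 1 + - (1 / 6)"
    using mom by simp
  also have "\<dots> \<le> exp (- (1 / 6))"
    by (rule exp_ge_add_one_self)
  finally show ?thesis
    by (simp add: S_def ennreal_leI)
qed

text \<open>Markov's inequality for the exponential of the sum, which independence factorises. The
  Chernoff parameter is absorbed into \<open>Z\<close>, so that positive multiples of squares give
  upper tails and negative multiples give lower tails.\<close>

lemma indep_chernoff:
  fixes Z :: "'i \<Rightarrow> 'a \<Rightarrow> real"
  assumes "finite T" and ind: "indep_vars (\<lambda>_. borel) Z T"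
    and mgf: "\<And>i. i \<in> T \<Longrightarrow> (\<integral>\<^sup>+w. exp (Z i w) \<partial>M) \<le> ennreal c" and "c \<ge> 0"
  shows "prob {w \<in> space M. t \<le> (\<Sum>i\<in>T. Z i w)} \<le> exp (- t) * c ^ card T"
proof -
  have [measurable]: "random_variable borel (Z i)" if "i \<in> T" for i
    using ind that by (auto simp: indep_vars_def)
  have "emeasure M {w \<in> space M. t \<le> (\<Sum>i\<in>T. Z i w)}
      = emeasure M {w \<in> space M. 1 \<le> ennreal (exp (- t)) * ennreal (exp (\<Sum>i\<in>T. Z i w))}"
    by (intro arg_cong[where f = "emeasure M"])
      (auto simp: ennreal_mult'[symmetric] exp_add[symmetric] ennreal_1[symmetric]
        simp del: ennreal_1)
  also have "\<dots> \<le> ennreal (exp (- t))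
      * (\<integral>\<^sup>+w. ennreal (exp (\<Sum>i\<in>T. Z i w)) * indicator (space M) w \<partial>M)"
    by (rule nn_integral_Markov_inequality) auto
  also have "(\<integral>\<^sup>+w. ennreal (exp (\<Sum>i\<in>T. Z i w)) * indicator (space M) w \<partial>M)
      = (\<integral>\<^sup>+w. (\<Prod>i\<in>T. ennreal (exp (Z i w))) \<partial>M)"
    using \<open>finite T\<close> by (intro nn_integral_cong) (simp add: exp_sum prod_ennreal)
  also have "\<dots> = (\<Prod>i\<in>T. \<integral>\<^sup>+w. ennreal (exp (Z i w)) \<partial>M)"
    by (intro indep_vars_nn_integral \<open>finite T\<close> indep_vars_compose2[OF ind]) auto
  also have "\<dots> \<le> (\<Prod>i\<in>T. ennreal c)"
    by (intro prod_mono_ennreal mgf)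
  also have "ennreal (exp (- t)) * (\<Prod>i\<in>T. ennreal c) = ennreal (exp (- t) * c ^ card T)"
    using \<open>c \<ge> 0\<close> by (simp add: ennreal_power ennreal_mult)
  finally show ?thesis
    using \<open>c \<ge> 0\<close> by (simp add: emeasure_eq_measure mult_left_mono)
qed

end

section \<open>Real estimates: a logarithm bound, the entropy bound for subsets, the location of
  \<open>t_pm1\<close>\<close>

text \<open>The difference of the two sides has derivative
  \<open>t * (2 - t) / (3 * (1 + t))\<close>, which is nonnegative up to 2. Half of the constant
  \<open>1 / 6\<close> becomes the rate \<open>\<epsilon>\<^sup>2 / 12\<close> of the upper tail,
  hence the 12 in \<open>omega_tilde\<close>.\<close>

lemma ln_one_plus_le:
  fixes x :: real
  assumes "0 \<le> x" "x \<le> 2"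
  shows "ln (1 + x) \<le> x - x\<^sup>2 / 6"
proof -
  have "(\<lambda>x. x - x\<^sup>2 / 6 - ln (1 + x)) 0 \<le> (\<lambda>x. x - x\<^sup>2 / 6 - ln (1 + x)) x"
  proof (rule DERIV_nonneg_imp_nondecreasing[OF assms(1)])
    fix t assume t: "0 \<le> t" "t \<le> x"
    have "1 - t / 3 - 1 / (1 + t) = t * (2 - t) / (3 * (1 + t))"
      using t by (simp add: field_simps)
    also have "\<dots> \<ge> 0"
      using t assms by simp
    finally show "\<exists>y. ((\<lambda>x. x - x\<^sup>2 / 6 - ln (1 + x)) has_real_derivative y) (at t) \<and> 0 \<le> y"
      using t by (intro exI[of _ "1 - t / 3 - 1 / (1 + t)"])
        (auto intro!: derivative_eq_intros simp: field_simps)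
  qed
  then show ?thesis by simp
qed

text \<open>The weights \<open>(1 - \<beta>)\<^bsup>|T|\<^esup> \<beta>\<^bsup>n - |T|\<^esup>\<close> sum to 1 over all \<open>T\<close>.\<close>

lemma card_large_subsets_le:
  fixes \<beta> :: real
  assumes \<beta>: "0 < \<beta>" "\<beta> \<le> 1 / 2"
  shows "real (card {T :: 'n::finite set. real (card (- T)) \<le> \<beta> * real CARD('n)})
    \<le> exp (- ((1 - \<beta>) * ln (1 - \<beta>) + \<beta> * ln \<beta>) * real CARD('n))"
proof -
  define n where "n = real CARD('n)"
  define E where "E = (1 - \<beta>) * ln (1 - \<beta>) + \<beta> * ln \<beta>"
  let ?\<T> = "{T :: 'n set. real (card (- T)) \<le> \<beta> * n}"
  have weight: "exp (E * n) \<le> (1 - \<beta>) ^ card T * \<beta> ^ card (- T)" if "T \<in> ?\<T>" for T :: "'n set"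
  proof -
    have cT: "real (card T) = n - real (card (- T))"
      using card_Un_disjoint[of T "- T"] by (simp add: n_def)
    \<comment> \<open>Since \<open>\<beta> \<le> 1 / 2\<close>, the weight can only grow when the
      complement shrinks. It is therefore at least its value at the extreme size
      \<open>\<beta> * n\<close>, which is \<open>exp (E * n)\<close>.\<close>
    have "0 \<le> (\<beta> * n - real (card (- T))) * (ln (1 - \<beta>) - ln \<beta>)"
      using that \<beta> by simp
    then have "E * n \<le> real (card T) * ln (1 - \<beta>) + real (card (- T)) * ln \<beta>"
      unfolding cT E_def by (simp add: algebra_simps)
    then have "exp (E * n) \<le> exp (real (card T) * ln (1 - \<beta>) + real (card (- T)) * ln \<beta>)"
      by simp
    also have "\<dots> = (1 - \<beta>) ^ card T * \<beta> ^ card (- T)"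
      using \<beta> by (simp add: exp_add exp_of_nat_mult)
    finally show ?thesis .
  qed
  have "real (card ?\<T>) * exp (E * n) = (\<Sum>T\<in>?\<T>. exp (E * n))"
    by simp
  also have "\<dots> \<le> (\<Sum>T\<in>?\<T>. (1 - \<beta>) ^ card T * \<beta> ^ card (- T))"
    by (intro sum_mono weight)
  also have "\<dots> \<le> (\<Sum>T\<in>Pow (UNIV :: 'n set). (1 - \<beta>) ^ card T * \<beta> ^ card (- T))"
    using \<beta> by (intro sum_mono2) auto
  also have "\<dots> = (\<Prod>i\<in>(UNIV :: 'n set). (1 - \<beta>) + \<beta>)"
    by (subst prod_add) (auto simp: Compl_eq_Diff_UNIV)
  also have "\<dots> = 1"
    by simp
  finally show ?thesis
    unfolding E_def[symmetric] n_def[symmetric] by (simp add: exp_minus field_simps)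
qed

text \<open>The definite description says something about \<open>t_pm1\<close> only once a unique
  zero is known. Strict decrease gives uniqueness, and a change of sign gives existence.\<close>

lemma t_pm1_less_half: "t_pm1 < 1 / 2"
proof -
  define f :: "real \<Rightarrow> real" where
    "f = (\<lambda>t. (1 - t) * ln (1 - t) + t * ln t + 1 / 6 * (1 - t))"
  have der: "(f has_real_derivative - ln (1 - t) + ln t - 1 / 6) (at t)" if "0 < t" "t < 1" for t
    unfolding f_def using that by (auto intro!: derivative_eq_intros)
  have dec: "f y < f x" if "0 < x" "x < y" "y \<le> 1 / 2" for x y
  proof (rule DERIV_neg_imp_decreasing[OF \<open>x < y\<close>])
    fix t assume "x \<le> t" "t \<le> y"
    then have t: "0 < t" "t \<le> 1 - t" "t < 1"
      using that by auto
    then have "ln t \<le> ln (1 - t)"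
      by simp
    then have "- ln (1 - t) + ln t - 1 / 6 < 0"
      by linarith
    then show "\<exists>z. (f has_real_derivative z) (at t) \<and> z < 0"
      using der t by blast
  qed
  \<comment> \<open>A small point at which \<open>ln x \<le> x - 1\<close> suffices. Writing
    \<open>ln 10000\<close> as \<open>2 * ln 100\<close> bounds it by 198, so the term
    \<open>t * ln t\<close> is at least -0.0198, against about 1/6 from the linear term.\<close>
  have pos: "f (1 / 10000) > 0"
  proof -
    have "ln (100 :: real) \<le> 99"
      using ln_le_minus_one[of "100 :: real"] by simp
    moreover have "ln (1 / 10000 :: real) = - 2 * ln 100"
      using ln_realpow[of "100 :: real" 2] by (simp add: ln_div)
    moreover have "ln (10000 / 9999 :: real) \<le> 1 / 9999"
      using ln_le_minus_one[of "10000 / 9999 :: real"] by simp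
    moreover have "ln (9999 / 10000 :: real) = - ln (10000 / 9999)"
      by (simp add: ln_div)
    ultimately show ?thesis
      by (simp add: f_def)
  qed
  have neg: "f (1 / 2) < 0"
    using ln2_ge_two_thirds by (simp add: f_def ln_div)
  have "\<exists>t\<ge>1 / 10000. t \<le> 1 / 2 \<and> f t = 0"
    using pos neg by (intro IVT2) (auto intro!: DERIV_isCont[OF der])
  then obtain t where "1 / 10000 \<le> t" "t \<le> 1 / 2" "f t = 0"
    by blast
  moreover from this have "t \<noteq> 1 / 2"
    using neg by (metis less_irrefl)
  ultimately have t: "0 < t" "t < 1 / 2" "f t = 0"
    by auto
  have "t_pm1 = t"
    unfolding t_pm1_def
  proof (rule the_equality)
    show "0 < t \<and> t < 1 / 2 \<and> (1 - t) * ln (1 - t) + t * ln t + 1 / 6 * (1 - t) = 0"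
      using t by (simp add: f_def)
  next
    fix s :: real
    assume "0 < s \<and> s < 1 / 2 \<and> (1 - s) * ln (1 - s) + s * ln s + 1 / 6 * (1 - s) = 0"
    then have s: "0 < s" "s < 1 / 2" "f s = 0"
      by (auto simp: f_def)
    then show "s = t"
      using t dec[of s t] dec[of t s] by (cases s t rule: linorder_cases) auto
  qed
  then show ?thesis
    using t by simp
qed

section \<open>Tail bounds for a Bernoulli matrix applied to one vector\<close>

lemma norm_rows_power2: "(norm_rows A T x)\<^sup>2 = (\<Sum>i\<in>T. (row i A \<bullet> x)\<^sup>2)"
  by (simp add: norm_rows_def L2_set_def sum_nonneg)

lemma norm_rows_scaleR_power2: "(norm_rows A T (c *\<^sub>R x))\<^sup>2 = c\<^sup>2 * (norm_rows A T x)\<^sup>2"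
  by (simp add: norm_rows_power2 power_mult_distrib sum_distrib_left)

context prob_space
begin

text \<open>Each dot product is a measurable function of one row of entries, and distinct rows are
  disjoint blocks of the independent family of entries.\<close>

lemma bernoulli_matrix_indep_rows:
  fixes \<Phi> :: "'a \<Rightarrow> real ^ 'm::finite ^ 'n::finite"
  assumes "bernoulli_matrix \<Phi>"
  shows "indep_vars (\<lambda>_. borel) (\<lambda>i w. row i (\<Phi> w) \<bullet> x) UNIV"
proof -
  let ?X = "\<lambda>p w. (\<lambda>(i, j) w. \<Phi> w $ i $ j) p w"
  have ind: "indep_vars (\<lambda>_. borel) ?X (UNIV :: ('n \<times> 'm) set)"
    using assms by (simp add: bernoulli_matrix_def)
  have "indep_vars (\<lambda>i. PiM ({i} \<times> UNIV) (\<lambda>_. borel))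
      (\<lambda>i w. restrict (\<lambda>p. ?X p w) ({i} \<times> UNIV)) (UNIV :: 'n set)"
    by (rule indep_vars_restrict[OF ind]) (auto simp: disjoint_family_on_def)
  then have "indep_vars (\<lambda>_. borel)
      (\<lambda>i w. (\<lambda>f. \<Sum>j\<in>UNIV. x $ j * f (i, j)) (restrict (\<lambda>p. ?X p w) ({i} \<times> UNIV))) UNIV"
    by (rule indep_vars_compose2) measurable
  then show ?thesis
    by (simp add: inner_vec_def row_def mult.commute)
qed

lemma bernoulli_matrix_row:
  fixes \<Phi> :: "'a \<Rightarrow> real ^ 'm::finite ^ 'n::finite"
  assumes "bernoulli_matrix \<Phi>" and "norm x = 1"
  shows "(\<integral>\<^sup>+w. exp (l * (row i (\<Phi> w) \<bullet> x)) \<partial>M) \<le> ennreal (exp (l\<^sup>2 / 2))"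
    and "(\<integral>\<^sup>+w. exp (- (1 / 3) * (row i (\<Phi> w) \<bullet> x)\<^sup>2) \<partial>M) \<le> ennreal (exp (- (1 / 6)))"
proof -
  let ?X = "\<lambda>p w. (\<lambda>(i, j) w. \<Phi> w $ i $ j) p w"
  let ?J = "{i} \<times> (UNIV :: 'm set)"
  have sum: "(\<Sum>p\<in>?J. f p) = (\<Sum>j\<in>UNIV. f (i, j))" for f :: "'n \<times> 'm \<Rightarrow> real"
    by (subst Sigma_def) (simp add: UNION_singleton_eq_range sum.reindex inj_on_def)
  have row: "(\<Sum>p\<in>?J. x $ snd p * ?X p w) = row i (\<Phi> w) \<bullet> x" for w
    by (simp add: sum inner_vec_def row_def mult.commute)
  have unit: "(\<Sum>p\<in>?J. (x $ snd p)\<^sup>2) = 1"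
    using assms(2) by (simp add: sum norm_vec_def L2_set_def)
  have "indep_vars (\<lambda>_. borel) ?X (UNIV :: ('n \<times> 'm) set)"
    using assms(1) by (simp add: bernoulli_matrix_def)
  then have ind: "indep_vars (\<lambda>_. borel) ?X ?J"
    by (rule indep_vars_subset) simp
  have sb: "symmetric_bernoulli (?X p)" for p
    using assms(1) by (cases p) (simp add: bernoulli_matrix_def)
  show "(\<integral>\<^sup>+w. exp (l * (row i (\<Phi> w) \<bullet> x)) \<partial>M) \<le> ennreal (exp (l\<^sup>2 / 2))"
    using rademacher_sum_mgf[OF _ ind sb, where a = "\<lambda>p. x $ snd p" and l = l]
    unfolding row unit by simp
  show "(\<integral>\<^sup>+w. exp (- (1 / 3) * (row i (\<Phi> w) \<bullet> x)\<^sup>2) \<partial>M) \<le> ennreal (exp (- (1 / 6)))"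
    using rademacher_sum_laplace[OF _ ind sb, where a = "\<lambda>p. x $ snd p"]
    unfolding row unit by simp
qed

lemma bernoulli_matrix_upper_tail:
  fixes \<Phi> :: "'a \<Rightarrow> real ^ 'm::finite ^ 'n::finite"
  assumes \<Phi>: "bernoulli_matrix \<Phi>" and x: "norm x = 1" and \<epsilon>: "0 < \<epsilon>" "\<epsilon> \<le> 2"
  shows "prob {w \<in> space M. real CARD('n) * (1 + \<epsilon>) \<le> (norm_rows (\<Phi> w) UNIV x)\<^sup>2}
    \<le> exp (- (\<epsilon>\<^sup>2 / 12) * real CARD('n))"
proof -
  define n where "n = real CARD('n)"
  \<comment> \<open>The optimal Chernoff parameter: it minimises the exponent
    \<open>- h * (1 + \<epsilon>) - ln (1 - 2 * h) / 2\<close> per row.\<close>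
  define h where "h = \<epsilon> / (2 * (1 + \<epsilon>))"
  have h: "0 < h" "h < 1 / 2" "1 - 2 * h = 1 / (1 + \<epsilon>)" "h * (1 + \<epsilon>) = \<epsilon> / 2"
    using \<epsilon> by (auto simp: h_def field_simps)
  have ind: "indep_vars (\<lambda>_. borel) (\<lambda>i w. row i (\<Phi> w) \<bullet> x) UNIV"
    by (rule bernoulli_matrix_indep_rows[OF \<Phi>])
  then have [measurable]: "random_variable borel (\<lambda>w. row i (\<Phi> w) \<bullet> x)" for i
    by (auto simp: indep_vars_def)
  have "(\<integral>\<^sup>+w. exp (h * (row i (\<Phi> w) \<bullet> x)\<^sup>2) \<partial>M) \<le> ennreal (sqrt (1 + \<epsilon>))" for i
    using subgaussian_square_mgf[OF _ bernoulli_matrix_row(1)[OF \<Phi> x], of i h] h \<epsilon>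
    by (simp add: real_sqrt_divide)
  then have "prob {w \<in> space M. h * (n * (1 + \<epsilon>)) \<le> (\<Sum>i\<in>UNIV. h * (row i (\<Phi> w) \<bullet> x)\<^sup>2)}
      \<le> exp (- (h * (n * (1 + \<epsilon>)))) * sqrt (1 + \<epsilon>) ^ CARD('n)"
    by (intro indep_chernoff indep_vars_compose2[OF ind]) (use \<epsilon> in auto)
  also have "{w \<in> space M. h * (n * (1 + \<epsilon>)) \<le> (\<Sum>i\<in>UNIV. h * (row i (\<Phi> w) \<bullet> x)\<^sup>2)}
      = {w \<in> space M. n * (1 + \<epsilon>) \<le> (norm_rows (\<Phi> w) UNIV x)\<^sup>2}"
    using h by (simp add: norm_rows_power2 flip: sum_distrib_left)
  also have "sqrt (1 + \<epsilon>) ^ CARD('n) = exp (n * (ln (1 + \<epsilon>) / 2))"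
    using \<epsilon> by (simp add: n_def exp_of_nat_mult flip: ln_sqrt)
  also have "h * (n * (1 + \<epsilon>)) = n * (\<epsilon> / 2)"
    by (subst mult.left_commute) (simp add: h(4))
  also have "exp (- (n * (\<epsilon> / 2))) * exp (n * (ln (1 + \<epsilon>) / 2)) = exp (n * (ln (1 + \<epsilon>) - \<epsilon>) / 2)"
    by (simp add: exp_add[symmetric] right_diff_distrib diff_divide_distrib)
  also have "\<dots> \<le> exp (- (\<epsilon>\<^sup>2 / 12) * n)"
  proof -
    have "n * (ln (1 + \<epsilon>) - \<epsilon>) \<le> n * (- (\<epsilon>\<^sup>2 / 6))"
      using ln_one_plus_le[of \<epsilon>] \<epsilon> by (intro mult_left_mono) (auto simp: n_def)
    then show ?thesis by (simp add: mult.commute)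
  qed
  finally show ?thesis by (simp add: n_def)
qed

text \<open>Each row contributes the factor \<open>exp (- (1 / 6))\<close> and the threshold costs
  \<open>exp (s / 3)\<close>. The bound is below 1 exactly when \<open>s < card T / 2\<close>, which
  is the origin of the \<open>1 / 2\<close> in \<open>theta_tilde\<close>.\<close>

lemma bernoulli_matrix_lower_tail:
  fixes \<Phi> :: "'a \<Rightarrow> real ^ 'm::finite ^ 'n::finite"
  assumes \<Phi>: "bernoulli_matrix \<Phi>" and x: "norm x = 1"
  shows "prob {w \<in> space M. (norm_rows (\<Phi> w) T x)\<^sup>2 \<le> s} \<le> exp (s / 3 - real (card T) / 6)"
proof -
  have "indep_vars (\<lambda>_. borel) (\<lambda>i w. row i (\<Phi> w) \<bullet> x) UNIV"
    by (rule bernoulli_matrix_indep_rows[OF \<Phi>])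
  then have ind: "indep_vars (\<lambda>_. borel) (\<lambda>i w. row i (\<Phi> w) \<bullet> x) T"
    by (rule indep_vars_subset) simp
  have "prob {w \<in> space M. - s / 3 \<le> (\<Sum>i\<in>T. - (1 / 3) * (row i (\<Phi> w) \<bullet> x)\<^sup>2)}
      \<le> exp (- (- s / 3)) * exp (- (1 / 6)) ^ card T"
    by (intro indep_chernoff indep_vars_compose2[OF ind] bernoulli_matrix_row[OF \<Phi> x]) auto
  also have "{w \<in> space M. - s / 3 \<le> (\<Sum>i\<in>T. - (1 / 3) * (row i (\<Phi> w) \<bullet> x)\<^sup>2)}
      = {w \<in> space M. (norm_rows (\<Phi> w) T x)\<^sup>2 \<le> s}"
    unfolding norm_rows_power2 sum_distrib_left[symmetric] by (intro Collect_cong) auto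
  also have "exp (- (- s / 3)) * exp (- (1 / 6)) ^ card T = exp (s / 3 - real (card T) / 6)"
    by (simp add: exp_of_nat_mult[symmetric] exp_add[symmetric])
  finally show ?thesis .
qed

end

section \<open>The good event for one vector and its deterministic consequences\<close>

text \<open>One event from which all four inequalities of the theorem follow. The lower bound is
  normalised by \<open>card T\<close>, the stronger form, and the upper bound is required only for
  the full set of rows.\<close>

definition well_concentrated :: "real \<Rightarrow> real \<Rightarrow> real ^ 'm::finite ^ 'n::finite \<Rightarrow> real ^ 'm \<Rightarrow> bool" where
  "well_concentrated \<beta> \<alpha> A u \<longleftrightarrow>
     (norm_rows A UNIV u)\<^sup>2 \<le> real CARD('n) * omega_tilde \<alpha> * (norm u)\<^sup>2 \<and>
     (\<forall>T :: 'n set. real (card (- T)) \<le> \<beta> * real CARD('n) \<longrightarrow>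
        theta_tilde \<beta> \<alpha> / (1 - \<beta>) * real (card T) * (norm u)\<^sup>2 \<le> (norm_rows A T u)\<^sup>2)"

text \<open>Both sides are quadratic in \<open>u\<close>. This reduces the probability bound to unit
  vectors and, with \<open>c = - 1\<close>, makes the event for \<open>x - y\<close> symmetric in
  the two points.\<close>

lemma well_concentrated_scaleR:
  assumes "well_concentrated \<beta> \<alpha> A u"
  shows "well_concentrated \<beta> \<alpha> A (c *\<^sub>R u)"
proof -
  have "c\<^sup>2 * a \<le> c\<^sup>2 * b" if "a \<le> b" for a b
    using that by (simp add: mult_left_mono)
  then show ?thesis
    using assms unfolding well_concentrated_def norm_rows_scaleR_power2 norm_scaleR
      power_mult_distrib power2_abs mult.left_commute[of _ "c\<^sup>2"]
    by blast
qed

lemma card_complement_ge: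
  fixes T :: "'n::finite set"
  assumes "real (card (- T)) \<le> \<beta> * real CARD('n)"
  shows "(1 - \<beta>) * real CARD('n) \<le> real (card T)"
  using assms card_Un_disjoint[of T "- T"] by (simp add: algebra_simps)

lemma well_concentrated_bounds:
  fixes A :: "real ^ 'm::finite ^ 'n::finite" and T :: "'n set"
  assumes good: "well_concentrated \<beta> \<alpha> A u"
    and T: "real (card (- T)) \<le> \<beta> * real CARD('n)"
    and \<beta>: "0 < \<beta>" "\<beta> < 1 / 2" and \<alpha>: "0 < \<alpha>" "\<alpha> < 1 / 12"
    and \<theta>: "0 \<le> theta_tilde \<beta> \<alpha>"
  shows "theta_tilde \<beta> \<alpha> * (norm u)\<^sup>2 \<le> 1 / real CARD('n) * (norm_rows A T u)\<^sup>2"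
    and "1 / real CARD('n) * (norm_rows A T u)\<^sup>2 \<le> omega_tilde \<alpha> * (norm u)\<^sup>2"
    and "theta_tilde \<beta> \<alpha> / (1 - \<beta>) * (norm u)\<^sup>2 \<le> 1 / real (card T) * (norm_rows A T u)\<^sup>2"
    and "1 / real (card T) * (norm_rows A T u)\<^sup>2 \<le> omega \<beta> \<alpha> * (norm u)\<^sup>2"
proof -
  define n where "n = real CARD('n)"
  define k where "k = real (card T)"
  define U where "U = (norm u)\<^sup>2"
  define R where "R = (norm_rows A T u)\<^sup>2"
  define \<theta> where "\<theta> = theta_tilde \<beta> \<alpha> / (1 - \<beta>)"
  have n: "n > 0" and U: "U \<ge> 0"
    by (auto simp: n_def U_def)
  have kn: "(1 - \<beta>) * n \<le> k"
    using card_complement_ge[OF T] by (simp add: n_def k_def)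
  \<comment> \<open>\<open>T\<close> is nonempty, so the divisions by \<open>card T\<close> below
    are never divisions by zero.\<close>
  have "0 < (1 - \<beta>) * n"
    using \<beta> n by simp
  with kn have k: "k > 0"
    by linarith
  have \<theta>0: "\<theta> \<ge> 0" and theta: "theta_tilde \<beta> \<alpha> = \<theta> * (1 - \<beta>)"
    using \<theta> \<beta> by (auto simp: \<theta>_def)
  have low: "\<theta> * k * U \<le> R"
    using good T unfolding well_concentrated_def \<theta>_def k_def U_def R_def by blast
  have "R \<le> (norm_rows A UNIV u)\<^sup>2"
    unfolding R_def norm_rows_power2 by (intro sum_mono2) auto
  also have "\<dots> \<le> n * omega_tilde \<alpha> * U"
    using good unfolding well_concentrated_def n_def U_def by blast
  finally have up: "R \<le> n * omega_tilde \<alpha> * U" .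
  \<comment> \<open>Replacing \<open>card T\<close> by the smaller \<open>(1 - \<beta>) * n\<close>
    weakens the lower bound only because \<theta> is nonnegative.\<close>
  have "\<theta> * ((1 - \<beta>) * n) * U \<le> \<theta> * k * U"
    using \<theta>0 U kn by (intro mult_right_mono mult_left_mono)
  then have "theta_tilde \<beta> \<alpha> * U * n \<le> R"
    using low by (simp add: theta mult_ac)
  then show "theta_tilde \<beta> \<alpha> * (norm u)\<^sup>2 \<le> 1 / real CARD('n) * (norm_rows A T u)\<^sup>2"
    using n unfolding U_def[symmetric] R_def[symmetric] n_def[symmetric] by (simp add: pos_le_divide_eq)
  show "1 / real CARD('n) * (norm_rows A T u)\<^sup>2 \<le> omega_tilde \<alpha> * (norm u)\<^sup>2"
    using up n unfolding U_def[symmetric] R_def[symmetric] n_def[symmetric]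
    by (simp add: pos_divide_le_eq mult_ac)
  show "theta_tilde \<beta> \<alpha> / (1 - \<beta>) * (norm u)\<^sup>2 \<le> 1 / real (card T) * (norm_rows A T u)\<^sup>2"
    using low k unfolding U_def[symmetric] R_def[symmetric] k_def[symmetric] \<theta>_def[symmetric]
    by (simp add: pos_le_divide_eq mult_ac)
  have "omega_tilde \<alpha> \<le> 2"
    using \<alpha> by (simp add: omega_tilde_def)
  then have "omega_tilde \<alpha> * n \<le> 2 * n"
    using n by simp
  also have "\<dots> \<le> 4 * ((1 - \<beta>) * n)"
    using \<beta> n by (simp add: algebra_simps)
  also have "\<dots> \<le> 4 * k"
    using kn by simp
  also have "\<dots> \<le> omega \<beta> \<alpha> * k"
  proof (intro mult_right_mono)
    \<comment> \<open>The second square root in \<open>omega\<close> already suffices: its square is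
      at least \<open>2 * 2 * 1\<close>.\<close>
    have e: "2 \<le> exp (1 :: real)"
      using exp_ge_add_one_self[of "1 :: real"] by simp
    have "ln (exp 1 / (1 - \<beta>)) = 1 - ln (1 - \<beta>)"
      using \<beta> by (simp add: ln_div)
    moreover have "ln (1 - \<beta>) \<le> 0"
      using \<beta> by simp
    ultimately have ln1: "0 \<le> ln (exp 1 / (1 - \<beta>))" "1 \<le> ln (exp 1 / (1 - \<beta>))"
      by linarith+
    have "4 \<le> 2 * exp 1 * ln (exp 1 / (1 - \<beta>))"
      using mult_mono[OF e ln1(2)] by simp
    also have "\<dots> = (sqrt (2 * exp 1 * ln (exp 1 / (1 - \<beta>))))\<^sup>2"
      using ln1 by simp
    also have "\<dots> \<le> omega \<beta> \<alpha>"
      unfolding omega_def using \<alpha> \<beta> ln1 by (intro power_mono) (auto simp: zero_le_mult_iff)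
    finally show "4 \<le> omega \<beta> \<alpha>" .
  qed (use k in simp)
  finally have "omega_tilde \<alpha> * n * U \<le> omega \<beta> \<alpha> * k * U"
    using U by (rule mult_right_mono)
  then show "1 / real (card T) * (norm_rows A T u)\<^sup>2 \<le> omega \<beta> \<alpha> * (norm u)\<^sup>2"
    using up k unfolding U_def[symmetric] R_def[symmetric] k_def[symmetric]
    by (simp add: pos_divide_le_eq mult_ac)
qed

section \<open>Probability of the good event and union bounds\<close>

context prob_space
begin

lemma bernoulli_matrix_measurable_norm_rows:
  fixes \<Phi> :: "'a \<Rightarrow> real ^ 'm::finite ^ 'n::finite"
  assumes "bernoulli_matrix \<Phi>"
  shows "random_variable borel (\<lambda>w. (norm_rows (\<Phi> w) T x)\<^sup>2)"
proof -
  have [measurable]: "random_variable borel (\<lambda>w. row i (\<Phi> w) \<bullet> x)" for i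
    using bernoulli_matrix_indep_rows[OF assms] by (auto simp: indep_vars_def)
  show ?thesis
    unfolding norm_rows_power2 by measurable
qed

lemma sets_Collect_well_concentrated:
  fixes \<Phi> :: "'a \<Rightarrow> real ^ 'm::finite ^ 'n::finite"
  assumes "bernoulli_matrix \<Phi>"
  shows "{w \<in> space M. well_concentrated \<beta> \<alpha> (\<Phi> w) u} \<in> events"
proof -
  note [measurable] = bernoulli_matrix_measurable_norm_rows[OF assms]
  show ?thesis
    unfolding well_concentrated_def by measurable
qed

text \<open>The upper tail costs one \<open>exp (- \<alpha> * n)\<close>, and the lower tails over
  all admissible \<open>T\<close> together cost another.\<close>

lemma bernoulli_matrix_not_well_concentrated:
  fixes \<Phi> :: "'a \<Rightarrow> real ^ 'm::finite ^ 'n::finite"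
  assumes \<Phi>: "bernoulli_matrix \<Phi>"
    and \<beta>: "0 < \<beta>" "\<beta> < 1 / 2" and \<alpha>: "0 < \<alpha>" "\<alpha> < 1 / 12"
  shows "prob {w \<in> space M. \<not> well_concentrated \<beta> \<alpha> (\<Phi> w) u} \<le> 2 * exp (- \<alpha> * real CARD('n))"
proof (cases "u = 0")
  case True
  then have "well_concentrated \<beta> \<alpha> (\<Phi> w) u" for w
    by (simp add: well_concentrated_def norm_rows_power2)
  then show ?thesis by simp
next
  case False
  define n where "n = real CARD('n)"
  define E where "E = (1 - \<beta>) * ln (1 - \<beta>) + \<beta> * ln \<beta>"
  define \<theta> where "\<theta> = theta_tilde \<beta> \<alpha> / (1 - \<beta>)"
  define v where "v = sgn u"
  have v: "norm v = 1" and u: "u = norm u *\<^sub>R v"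
    using False by (auto simp: v_def norm_sgn sgn_div_norm)
  note [measurable] = bernoulli_matrix_measurable_norm_rows[OF \<Phi>]
  define U where "U = {w \<in> space M. n * (1 + sqrt (12 * \<alpha>)) \<le> (norm_rows (\<Phi> w) UNIV v)\<^sup>2}"
  define L where "L T = {w \<in> space M. (norm_rows (\<Phi> w) T v)\<^sup>2 \<le> \<theta> * real (card T)}" for T
  let ?\<T> = "{T :: 'n set. real (card (- T)) \<le> \<beta> * real CARD('n)}"
  have [measurable]: "U \<in> events" "L T \<in> events" for T
    unfolding U_def L_def by measurable
  have "(\<beta> - 1) * ln (1 - \<beta>) \<ge> 0" "\<beta> * ln \<beta> \<le> 0"
    using \<beta> by (auto intro!: mult_nonpos_nonpos mult_nonneg_nonpos)
  then have E: "E \<le> 0"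
    by (simp add: E_def algebra_simps)
  have "ln ((1 - \<beta>) powr (1 - \<beta>) * \<beta> powr \<beta>) = E"
    using \<beta> by (simp add: E_def ln_mult ln_powr)
  then have "\<theta> = min (1 / 2 - 3 * inverse (1 - \<beta>) * (\<alpha> - E)) (1 / 2 - 3 * \<alpha>)"
    using \<beta> by (simp only: \<theta>_def theta_tilde_def) simp
  then have "\<theta> \<le> 1 / 2 - 3 * inverse (1 - \<beta>) * (\<alpha> - E)"
    by linarith
  moreover have "3 * inverse (1 - \<beta>) * (\<alpha> - E) = 3 * (\<alpha> - E) / (1 - \<beta>)"
    by (simp add: divide_inverse)
  ultimately have \<theta>: "\<theta> \<le> 1 / 2 - 3 * (\<alpha> - E) / (1 - \<beta>)"
    by linarith
  \<comment> \<open>The choice \<open>\<epsilon> = sqrt (12 * \<alpha>)\<close> turns the rate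
    \<open>\<epsilon>\<^sup>2 / 12\<close> into \<alpha>.\<close>
  have "prob U \<le> exp (- ((sqrt (12 * \<alpha>))\<^sup>2 / 12) * n)"
    unfolding U_def n_def
  proof (rule bernoulli_matrix_upper_tail[OF \<Phi> v])
    have "sqrt (12 * \<alpha>) \<le> 1"
      using \<alpha> by simp
    then show "sqrt (12 * \<alpha>) \<le> 2"
      by linarith
  qed (use \<alpha> in simp)
  also have "\<dots> = exp (- \<alpha> * n)"
    using \<alpha> by simp
  finally have U: "prob U \<le> exp (- \<alpha> * n)" .
  \<comment> \<open>The rate exceeds \<alpha> by \<open>- E\<close>, exactly the entropy rate of the
    number of sets \<open>T\<close>, so the union bound leaves
    \<open>exp (- \<alpha> * n)\<close>.\<close>
  have L: "prob (L T) \<le> exp (- (\<alpha> - E) * n)" if "T \<in> ?\<T>" for T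
  proof -
    define k where "k = real (card T)"
    have kn: "(1 - \<beta>) * n \<le> k"
      using card_complement_ge[of T \<beta>] that by (simp add: n_def k_def)
    have "prob (L T) \<le> exp (\<theta> * k / 3 - k / 6)"
      using bernoulli_matrix_lower_tail[OF \<Phi> v] by (simp add: L_def k_def)
    also have "\<theta> * k / 3 - k / 6 \<le> (1 / 2 - 3 * (\<alpha> - E) / (1 - \<beta>)) * k / 3 - k / 6"
      using \<theta> by (simp add: mult_right_mono k_def)
    also have "\<dots> = - (\<alpha> - E) * (k / (1 - \<beta>))"
      using \<beta> by (simp add: field_simps)
    \<comment> \<open>The factor \<open>- (\<alpha> - E)\<close> is negative since
      \<open>E \<le> 0 < \<alpha>\<close>, and \<open>k / (1 - \<beta>)\<close> is at least
      \<open>n\<close>.\<close>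
    also have "\<dots> \<le> - (\<alpha> - E) * n"
      using kn \<beta> \<alpha> E by (intro mult_left_mono_neg) (auto simp: field_simps)
    finally show ?thesis by simp
  qed
  have "{w \<in> space M. \<not> well_concentrated \<beta> \<alpha> (\<Phi> w) u} \<subseteq> U \<union> (\<Union>T\<in>?\<T>. L T)"
  proof (rule subsetI, rule ccontr)
    fix w
    assume w: "w \<in> {w \<in> space M. \<not> well_concentrated \<beta> \<alpha> (\<Phi> w) u}"
      and "w \<notin> U \<union> (\<Union>T\<in>?\<T>. L T)"
    then have "well_concentrated \<beta> \<alpha> (\<Phi> w) v"
      using v by (auto simp: well_concentrated_def U_def L_def \<theta>_def n_def omega_tilde_def)
    then have "well_concentrated \<beta> \<alpha> (\<Phi> w) u"
      by (subst u) (rule well_concentrated_scaleR)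
    with w show False
      by simp
  qed
  then have "prob {w \<in> space M. \<not> well_concentrated \<beta> \<alpha> (\<Phi> w) u} \<le> prob (U \<union> (\<Union>T\<in>?\<T>. L T))"
    by (intro finite_measure_mono) auto
  also have "\<dots> \<le> prob U + prob (\<Union>T\<in>?\<T>. L T)"
    by (intro measure_Un_le) auto
  also have "prob (\<Union>T\<in>?\<T>. L T) \<le> (\<Sum>T\<in>?\<T>. prob (L T))"
    by (intro measure_UNION_le) auto
  also have "\<dots> \<le> (\<Sum>T\<in>?\<T>. exp (- (\<alpha> - E) * n))"
    by (intro sum_mono L)
  also have "\<dots> = real (card ?\<T>) * exp (- (\<alpha> - E) * n)"
    by simp
  also have "\<dots> \<le> exp (- E * n) * exp (- (\<alpha> - E) * n)"
    using card_large_subsets_le[of \<beta>] \<beta> by (intro mult_right_mono) (auto simp: E_def n_def)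
  also have "\<dots> = exp (- \<alpha> * n)"
    by (simp add: exp_add[symmetric] algebra_simps)
  finally show ?thesis
    using U by (simp add: n_def)
qed

text \<open>
  Indexing by unordered pairs halves the union bound, which pays for the two tails of each pair.
\<close>

lemma bernoulli_matrix_pairwise_well_concentrated:
  fixes \<Phi> :: "'a \<Rightarrow> real ^ 'm::finite ^ 'n::finite"
  assumes \<Phi>: "bernoulli_matrix \<Phi>"
    and \<beta>: "0 < \<beta>" "\<beta> < 1 / 2" and \<alpha>: "0 < \<alpha>" "\<alpha> < 1 / 12"
    and P: "finite P"
  shows "prob {w \<in> space M. \<forall>x\<in>P. \<forall>y\<in>P. x \<noteq> y \<longrightarrow> well_concentrated \<beta> \<alpha> (\<Phi> w) (x - y)}
    \<ge> 1 - real (card P * (card P - 1)) * exp (- \<alpha> * real CARD('n))"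
proof -
  let ?good = "\<lambda>w x y. well_concentrated \<beta> \<alpha> (\<Phi> w) (x - y)"
  let ?G = "{w \<in> space M. \<forall>x\<in>P. \<forall>y\<in>P. x \<noteq> y \<longrightarrow> ?good w x y}"
  define \<P> where "\<P> = {e. e \<subseteq> P \<and> card e = 2}"
  \<comment> \<open>Quantifying over both orders of the pair avoids choosing one; by
    \<open>sym\<close> the two orders give the same event.\<close>
  define B where "B e = {w \<in> space M. \<exists>x\<in>e. \<exists>y\<in>e. x \<noteq> y \<and> \<not> ?good w x y}" for e
  have fin: "finite \<P>"
    using P by (auto simp: \<P>_def)
  have sym: "?good w y x \<longleftrightarrow> ?good w x y" for w x y
    using well_concentrated_scaleR[of \<beta> \<alpha> "\<Phi> w" "x - y" "- 1"]
      well_concentrated_scaleR[of \<beta> \<alpha> "\<Phi> w" "y - x" "- 1"] by auto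
  have B: "B e \<in> events" "prob (B e) \<le> 2 * exp (- \<alpha> * real CARD('n))" if e_in: "e \<in> \<P>" for e
  proof -
    obtain x y where e: "e = {x, y}" "x \<noteq> y"
      using e_in by (auto simp: \<P>_def card_2_iff)
    then have Be: "B e = {w \<in> space M. \<not> ?good w x y}"
      using sym by (auto simp: B_def)
    show "B e \<in> events"
      unfolding Be by (rule sets.sets_Collect_neg[OF sets_Collect_well_concentrated[OF \<Phi>]])
    show "prob (B e) \<le> 2 * exp (- \<alpha> * real CARD('n))"
      unfolding Be by (rule bernoulli_matrix_not_well_concentrated[OF \<Phi> \<beta> \<alpha>])
  qed
  have "?G = space M - (\<Union>e\<in>\<P>. B e)"
  proof (intro equalityI subsetI)
    fix w assume "w \<in> space M - (\<Union>e\<in>\<P>. B e)"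
    then have w: "w \<in> space M" "\<And>e. e \<in> \<P> \<Longrightarrow> w \<notin> B e"
      by auto
    have "?good w x y" if "x \<in> P" "y \<in> P" "x \<noteq> y" for x y
      using w(1) w(2)[of "{x, y}"] that by (auto simp: \<P>_def B_def)
    with w show "w \<in> ?G"
      by blast
  qed (auto simp: \<P>_def B_def)
  moreover have "prob (\<Union>e\<in>\<P>. B e) \<le> real (card P * (card P - 1)) * exp (- \<alpha> * real CARD('n))"
  proof -
    \<comment> \<open>The binomial coefficient is a natural number division by 2, which is exact by
      parity.\<close>
    have "even (card P * (card P - 1))"
      by auto
    then have "2 * card \<P> = card P * (card P - 1)"
      using P by (simp add: \<P>_def n_subsets choose_two)
    then have card: "real (card P * (card P - 1)) = 2 * real (card \<P>)"
      by (metis of_nat_mult of_nat_numeral)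
    have "prob (\<Union>e\<in>\<P>. B e) \<le> (\<Sum>e\<in>\<P>. prob (B e))"
      using fin B(1) by (intro measure_UNION_le) auto
    also have "\<dots> \<le> (\<Sum>e\<in>\<P>. 2 * exp (- \<alpha> * real CARD('n)))"
      by (intro sum_mono B(2))
    also have "\<dots> = real (card P * (card P - 1)) * exp (- \<alpha> * real CARD('n))"
      unfolding card by simp
    finally show ?thesis .
  qed
  moreover have "(\<Union>e\<in>\<P>. B e) \<in> events"
    using fin B(1) by auto
  ultimately show ?thesis
    by (simp add: prob_compl)
qed

end

section \<open>Both probability bounds from the common good event\<close>

theorem theorem3p7:
  fixes \<beta> q \<alpha> :: real and N :: nat
    and M :: "'a measure" and \<Phi> :: "'a \<Rightarrow> real ^ 'm::finite ^ 'n::finite"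
    and P :: "(real ^ 'm) set"
  assumes "prob_space M"
    and "0 < \<beta>" and "\<beta> < t_pm1"
    and "0 < q" and "q < 1 / 2" and "alpha_fun \<beta> q > 0"
    and "N \<ge> 2"
    and "0 < \<alpha>" and "\<alpha> < min (alpha_fun \<beta> q) (1 / 12)"
    and "real CARD('n) > inverse \<alpha> * ln (real (N * (N - 1)))"
    and "prob_space.bernoulli_matrix M \<Phi>"
    and "card P = N"
  shows "measure M {w \<in> space M. \<forall>T :: 'n set. real (card (- T)) \<le> \<beta> * real CARD('n) \<longrightarrow>
             (\<forall>x\<in>P. \<forall>y\<in>P. x \<noteq> y \<longrightarrow>
                theta_tilde \<beta> \<alpha> * (norm (x - y))\<^sup>2
                  \<le> 1 / real CARD('n) * (norm_rows (\<Phi> w) T (x - y))\<^sup>2 \<and>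
                1 / real CARD('n) * (norm_rows (\<Phi> w) T (x - y))\<^sup>2
                  \<le> omega_tilde \<alpha> * (norm (x - y))\<^sup>2)}
           \<ge> 1 - real (N * (N - 1)) * exp (- \<alpha> * real CARD('n))
       \<and> measure M {w \<in> space M. \<forall>T :: 'n set. real (card (- T)) \<le> \<beta> * real CARD('n) \<longrightarrow>
             (\<forall>x\<in>P. \<forall>y\<in>P. x \<noteq> y \<longrightarrow>
                theta_tilde \<beta> \<alpha> / (1 - \<beta>) * (norm (x - y))\<^sup>2
                  \<le> 1 / real (card T) * (norm_rows (\<Phi> w) T (x - y))\<^sup>2 \<and>
                1 / real (card T) * (norm_rows (\<Phi> w) T (x - y))\<^sup>2
                  \<le> omega \<beta> \<alpha> * (norm (x - y))\<^sup>2)}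
           \<ge> 1 - real (N * (N - 1)) * exp (- \<alpha> * real CARD('n))"
  (is "measure M ?A \<ge> ?p \<and> measure M ?B \<ge> ?p")
proof -
  interpret prob_space M by fact
  note \<Phi> = \<open>bernoulli_matrix \<Phi>\<close>
  note [measurable] = bernoulli_matrix_measurable_norm_rows[OF \<Phi>]
  have \<beta>: "0 < \<beta>" "\<beta> < 1 / 2"
    using \<open>0 < \<beta>\<close> \<open>\<beta> < t_pm1\<close> t_pm1_less_half by auto
  have \<alpha>: "0 < \<alpha>" "\<alpha> < 1 / 12" "\<alpha> < alpha_fun \<beta> q"
    using \<open>0 < \<alpha>\<close> \<open>\<alpha> < min (alpha_fun \<beta> q) (1 / 12)\<close> by auto
  \<comment> \<open>Infinite sets have cardinality 0, so \<open>N \<ge> 2\<close> forces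
    \<open>P\<close> to be finite.\<close>
  have "card P \<noteq> 0"
    using \<open>card P = N\<close> \<open>N \<ge> 2\<close> by simp
  then have P: "finite P"
    by (metis card.infinite)
  \<comment> \<open>Here \<open>q\<close> enters: \<open>\<alpha> < alpha_fun \<beta> q\<close> and
    \<open>q < 1 / 2\<close> bound \<open>\<alpha> - E\<close> by \<open>(1 - \<beta>) / 6\<close>,
    so the first argument of the minimum is nonnegative. The second is so by
    \<open>\<alpha> < 1 / 12\<close>.\<close>
  have \<theta>: "0 \<le> theta_tilde \<beta> \<alpha>"
  proof -
    define E where "E = ln ((1 - \<beta>) powr (1 - \<beta>) * \<beta> powr \<beta>)"
    have "E = (1 - \<beta>) * ln (1 - \<beta>) + \<beta> * ln \<beta>"
      using \<beta> by (simp add: E_def ln_mult ln_powr)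
    moreover have "q / 3 * (1 - \<beta>) \<le> 1 / 6 * (1 - \<beta>)"
      using \<open>q < 1 / 2\<close> \<beta> by (intro mult_right_mono) auto
    ultimately have "\<alpha> - E \<le> (1 - \<beta>) / 6"
      using \<alpha>(3) by (simp add: alpha_fun_def)
    then have "3 * inverse (1 - \<beta>) * (\<alpha> - E) \<le> 1 / 2"
      using \<beta> by (simp add: field_simps)
    then show ?thesis
      using \<alpha> \<beta> by (simp add: theta_tilde_def E_def)
  qed
  let ?G = "{w \<in> space M. \<forall>x\<in>P. \<forall>y\<in>P. x \<noteq> y \<longrightarrow> well_concentrated \<beta> \<alpha> (\<Phi> w) (x - y)}"
  have G: "?p \<le> prob ?G"
    using bernoulli_matrix_pairwise_well_concentrated[OF \<Phi> \<beta> \<alpha>(1,2) P] \<open>card P = N\<close> by simp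
  note bounds = well_concentrated_bounds[OF _ _ \<beta> \<alpha>(1,2) \<theta>]
  have "countable P"
    using P by (rule countable_finite)
  \<comment> \<open>Monotonicity of the measure requires the larger sets to be measurable.\<close>
  have "?A \<in> events" "?B \<in> events"
    using \<open>countable P\<close> by measurable
  moreover have "?G \<subseteq> ?A"
    by (intro subsetI CollectI conjI allI impI ballI bounds(1,2)) auto
  moreover have "?G \<subseteq> ?B"
    by (intro subsetI CollectI conjI allI impI ballI bounds(3,4)) auto
  ultimately have "prob ?G \<le> prob ?A" "prob ?G \<le> prob ?B"
    by (simp_all only: finite_measure_mono)
  with G show ?thesis
    by linarith
qed

end
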